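(* Let $n$ be a positive integer and let $\mathcal F\in\mathcal P$ be the hypergeometric series $$\mathcal F(w,x)=\sum_{d=0}^{\infty}x^d\,\frac{\prod_{r=1}^{nd}(nw+r)}{\prod_{r=1}^{d}\big((w+r)^n-w^n\big)}.$$ Then $\mathbf M^n\mathcal F=\mathcal F$.
   Context: $\mathcal P\subset 1+x\,\mathbb Q(w)[[x]]$ denotes the multiplicative group of power series in $x$ with constant term $1$ whose coefficients are rational functions of $w$ (over $\mathbb Q$) that are holomorphic (regular) at $w=0$. Thus $F(w,x)\mapsto F(0,x)\in 1+x\mathbb Q[[x]]$ is well defined on $\mathcal P$ (evaluate each coefficient at $w=0$). The map $\mathbf M:\mathcal P\to\mathcal P$ is defined by $$\mathbf M F(w,x)=\Big\{1+\frac{x}{w}\frac{\partial}{\partial x}\Big\}\frac{F(w,x)}{F(0,x)},$$ and $\mathbf M^n$ denotes its $n$-fold iterate. *)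

theory Defs
  imports "HOL-Computational_Algebra.Computational_Algebra"
begin

type_synonym ratfun = "rat poly fract"

definition ratfun_const :: "rat \<Rightarrow> ratfun" where
  "ratfun_const c = Fract [:c:] 1"

definition ratfun_w :: ratfun where
  "ratfun_w = Fract [:0, 1:] 1"

definition regular_at_0 :: "ratfun \<Rightarrow> bool" where
  "regular_at_0 f \<longleftrightarrow> (\<exists>a b. poly b 0 \<noteq> 0 \<and> f = Fract a b)"

(* The value at w = 0; it is meaningful only if f is regular at 0, see eval_at_0_Fract. *)
definition eval_at_0 :: "ratfun \<Rightarrow> rat" where
  "eval_at_0 f = (THE c. \<exists>a b. poly b 0 \<noteq> 0 \<and> f = Fract a b \<and> c = poly a 0 / poly b 0)"

definition series_P :: "ratfun fps set" where
  "series_P = {F. fps_nth F 0 = 1 \<and> (\<forall>d. regular_at_0 (fps_nth F d))}"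

definition fps_at_0 :: "ratfun fps \<Rightarrow> rat fps" where
  "fps_at_0 F = Abs_fps (\<lambda>d. eval_at_0 (fps_nth F d))"

definition fps_embed :: "rat fps \<Rightarrow> ratfun fps" where
  "fps_embed f = Abs_fps (\<lambda>d. ratfun_const (fps_nth f d))"

(* A total function, of interest only on series_P, which it maps to itself
   (map_M_in_series_P); there the divisor has constant term 1. *)
definition map_M :: "ratfun fps \<Rightarrow> ratfun fps" where
  "map_M F = (let G = F / fps_embed (fps_at_0 F)
              in G + fps_const (1 / ratfun_w) * fps_X * fps_deriv G)"

definition hypergeometric_F :: "nat \<Rightarrow> ratfun fps" where
  "hypergeometric_F n = Abs_fps (\<lambda>d.
     (\<Prod>r=1..n*d. (of_nat n * ratfun_w + of_nat r)) /
     (\<Prod>r=1..d. ((ratfun_w + of_nat r) ^ n - ratfun_w ^ n)))"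

lemma eval_at_0_Fract:
  assumes "poly b 0 \<noteq> 0"
  shows "eval_at_0 (Fract a b) = poly a 0 / poly b 0"
  unfolding eval_at_0_def
proof (rule the_equality)
  show "\<exists>a' b'. poly b' 0 \<noteq> 0 \<and> Fract a b = Fract a' b' \<and>
      poly a 0 / poly b 0 = poly a' 0 / poly b' 0"
    using assms by blast
next
  fix c
  assume "\<exists>a' b'. poly b' 0 \<noteq> 0 \<and> Fract a b = Fract a' b' \<and> c = poly a' 0 / poly b' 0"
  then obtain a' b' where *: "poly b' 0 \<noteq> 0" "Fract a b = Fract a' b'" "c = poly a' 0 / poly b' 0"
    by blast
  have "b \<noteq> 0" "b' \<noteq> 0" using assms * by auto
  with *(2) have "a * b' = a' * b" by (simp add: eq_fract)
  hence "poly a 0 * poly b' 0 = poly a' 0 * poly b 0" by (metis poly_mult)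
  thus "c = poly a 0 / poly b 0" using *(1,3) assms by (simp add: frac_eq_eq)
qed

lemma regular_at_0_Fract: "poly b 0 \<noteq> 0 \<Longrightarrow> regular_at_0 (Fract a b)"
  unfolding regular_at_0_def by blast

lemma regular_at_0E:
  assumes "regular_at_0 f"
  obtains a b where "poly b 0 \<noteq> 0" "b \<noteq> 0" "f = Fract a b"
  using assms unfolding regular_at_0_def by fastforce

lemma regular_at_0_const [simp]: "regular_at_0 (ratfun_const c)"
  unfolding ratfun_const_def by (rule regular_at_0_Fract) simp

lemma eval_at_0_const [simp]: "eval_at_0 (ratfun_const c) = c"
  unfolding ratfun_const_def by (simp add: eval_at_0_Fract)

lemma regular_at_0_w [simp]: "regular_at_0 ratfun_w"
  unfolding ratfun_w_def by (rule regular_at_0_Fract) simp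

lemma eval_at_0_w [simp]: "eval_at_0 ratfun_w = 0"
  unfolding ratfun_w_def by (simp add: eval_at_0_Fract)

lemma ratfun_w_nonzero [simp]: "ratfun_w \<noteq> 0"
  unfolding ratfun_w_def by (simp add: Zero_fract_def eq_fract)

lemma ratfun_const_0 [simp]: "ratfun_const 0 = 0"
  unfolding ratfun_const_def by (simp add: Zero_fract_def)

lemma ratfun_const_1 [simp]: "ratfun_const 1 = 1"
  unfolding ratfun_const_def by (simp add: One_fract_def flip: one_pCons)

lemma ratfun_const_of_nat: "ratfun_const (of_nat k) = of_nat k"
  unfolding ratfun_const_def by (simp add: of_nat_fract of_nat_poly)

lemma regular_at_0_0 [simp]: "regular_at_0 0" and eval_at_0_0 [simp]: "eval_at_0 0 = 0"
  using regular_at_0_const[of 0] eval_at_0_const[of 0] by simp_all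

lemma regular_at_0_1 [simp]: "regular_at_0 1" and eval_at_0_1 [simp]: "eval_at_0 1 = 1"
  using regular_at_0_const[of 1] eval_at_0_const[of 1] by simp_all

lemma regular_at_0_of_nat [simp]: "regular_at_0 (of_nat k)"
  and eval_at_0_of_nat [simp]: "eval_at_0 (of_nat k) = of_nat k"
  using regular_at_0_const[of "of_nat k"] eval_at_0_const[of "of_nat k"]
  by (simp_all add: ratfun_const_of_nat)

lemma
  assumes "regular_at_0 f" "regular_at_0 g"
  shows regular_at_0_add: "regular_at_0 (f + g)"
    and eval_at_0_add: "eval_at_0 (f + g) = eval_at_0 f + eval_at_0 g"
    and regular_at_0_diff: "regular_at_0 (f - g)"
    and eval_at_0_diff: "eval_at_0 (f - g) = eval_at_0 f - eval_at_0 g"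
    and regular_at_0_mult: "regular_at_0 (f * g)"
    and eval_at_0_mult: "eval_at_0 (f * g) = eval_at_0 f * eval_at_0 g"
proof -
  obtain a b where f: "poly b 0 \<noteq> 0" "b \<noteq> 0" "f = Fract a b"
    using assms(1) by (rule regular_at_0E)
  obtain c d where g: "poly d 0 \<noteq> 0" "d \<noteq> 0" "g = Fract c d"
    using assms(2) by (rule regular_at_0E)
  show "regular_at_0 (f + g)" "regular_at_0 (f - g)" "regular_at_0 (f * g)"
    using f g by (simp_all add: regular_at_0_Fract)
  show "eval_at_0 (f + g) = eval_at_0 f + eval_at_0 g"
    "eval_at_0 (f - g) = eval_at_0 f - eval_at_0 g"
    "eval_at_0 (f * g) = eval_at_0 f * eval_at_0 g"
    using f g by (simp_all add: eval_at_0_Fract field_simps)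
qed

lemma
  assumes "regular_at_0 f" "eval_at_0 f \<noteq> 0"
  shows regular_at_0_inverse: "regular_at_0 (inverse f)"
    and eval_at_0_inverse: "eval_at_0 (inverse f) = inverse (eval_at_0 f)"
proof -
  obtain a b where f: "poly b 0 \<noteq> 0" "b \<noteq> 0" "f = Fract a b"
    using assms(1) by (rule regular_at_0E)
  with assms(2) have "poly a 0 \<noteq> 0" by (auto simp: eval_at_0_Fract)
  with f show "regular_at_0 (inverse f)" "eval_at_0 (inverse f) = inverse (eval_at_0 f)"
    by (simp_all add: regular_at_0_Fract eval_at_0_Fract)
qed

lemma regular_at_0_divide_w:
  assumes "regular_at_0 f" "eval_at_0 f = 0"
  shows "regular_at_0 (f / ratfun_w)"
proof -
  obtain a b where f: "poly b 0 \<noteq> 0" "b \<noteq> 0" "f = Fract a b"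
    using assms(1) by (rule regular_at_0E)
  with assms(2) have "poly a 0 = 0" by (auto simp: eval_at_0_Fract)
  then obtain a' where a': "a = [:0, 1:] * a'"
    using poly_eq_0_iff_dvd[of a 0] by (auto elim: dvdE)
  have "f / ratfun_w = Fract a' b"
    using f a' by (simp add: ratfun_w_def eq_fract algebra_simps)
  with f show ?thesis by (simp add: regular_at_0_Fract)
qed

lemma regular_at_0_sum: "(\<And>i. i \<in> A \<Longrightarrow> regular_at_0 (f i)) \<Longrightarrow> regular_at_0 (sum f A)"
  by (induction A rule: infinite_finite_induct) (auto intro: regular_at_0_add)

lemma eval_at_0_sum:
  "(\<And>i. i \<in> A \<Longrightarrow> regular_at_0 (f i)) \<Longrightarrow> eval_at_0 (sum f A) = (\<Sum>i\<in>A. eval_at_0 (f i))"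
  by (induction A rule: infinite_finite_induct) (auto simp: eval_at_0_add regular_at_0_sum)

lemma regular_at_0_prod: "(\<And>i. i \<in> A \<Longrightarrow> regular_at_0 (f i)) \<Longrightarrow> regular_at_0 (prod f A)"
  by (induction A rule: infinite_finite_induct) (auto intro: regular_at_0_mult)

lemma eval_at_0_prod:
  "(\<And>i. i \<in> A \<Longrightarrow> regular_at_0 (f i)) \<Longrightarrow> eval_at_0 (prod f A) = (\<Prod>i\<in>A. eval_at_0 (f i))"
  by (induction A rule: infinite_finite_induct) (auto simp: eval_at_0_mult regular_at_0_prod)

lemma regular_at_0_power: "regular_at_0 f \<Longrightarrow> regular_at_0 (f ^ k)"
  by (induction k) (auto intro: regular_at_0_mult)

lemma eval_at_0_power: "regular_at_0 f \<Longrightarrow> eval_at_0 (f ^ k) = eval_at_0 f ^ k"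
  by (induction k) (auto simp: eval_at_0_mult regular_at_0_power)

lemma series_P_mult:
  assumes "F \<in> series_P" "G \<in> series_P"
  shows "F * G \<in> series_P" "fps_at_0 (F * G) = fps_at_0 F * fps_at_0 G"
  using assms
  by (auto simp: series_P_def fps_at_0_def fps_eq_iff fps_mult_nth eval_at_0_mult
      intro!: regular_at_0_sum regular_at_0_mult eval_at_0_sum[THEN trans] sum.cong)

lemma series_P_inverse:
  assumes "F \<in> series_P"
  shows "inverse F \<in> series_P"
proof -
  have F0: "fps_nth F 0 = 1" and F: "\<And>d. regular_at_0 (fps_nth F d)"
    using assms by (auto simp: series_P_def)
  have prod: "inverse F * F = 1"
    using F0 by (intro inverse_mult_eq_1) simp
  have I0: "fps_nth (inverse F) 0 = 1"
    using F0 by simp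
  have "regular_at_0 (fps_nth (inverse F) d)" for d
  proof (induction d rule: less_induct)
    case (less d)
    show ?case
    proof (cases "d = 0")
      case True
      thus ?thesis using I0 by simp
    next
      case False
      have "0 = fps_nth (inverse F * F) d"
        using False by (simp add: prod)
      also have "\<dots> = (\<Sum>i\<le>d. fps_nth (inverse F) i * fps_nth F (d - i))"
        by (simp add: fps_mult_nth atLeast0AtMost)
      also have "\<dots> = (\<Sum>i<d. fps_nth (inverse F) i * fps_nth F (d - i)) + fps_nth (inverse F) d"
        using F0 by (simp add: lessThan_Suc_atMost[symmetric])
      finally have "fps_nth (inverse F) d
          = 0 - (\<Sum>i<d. fps_nth (inverse F) i * fps_nth F (d - i))"
        by (simp add: eq_neg_iff_add_eq_0 add.commute)
      thus ?thesis
        using less F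
        by (auto simp del: diff_0 intro!: regular_at_0_diff regular_at_0_sum regular_at_0_mult)
    qed
  qed
  thus ?thesis using I0 by (auto simp: series_P_def)
qed

lemma fps_at_0_nth_0: "F \<in> series_P \<Longrightarrow> fps_nth (fps_at_0 F) 0 = 1"
  by (simp add: series_P_def fps_at_0_def)

lemma fps_embed_in_series_P: "fps_nth f 0 = 1 \<Longrightarrow> fps_embed f \<in> series_P"
  by (simp add: series_P_def fps_embed_def)

lemma fps_at_0_embed [simp]: "fps_at_0 (fps_embed f) = f"
  by (simp add: fps_at_0_def fps_embed_def fps_eq_iff)

lemma map_M_in_series_P:
  assumes "F \<in> series_P"
  shows "map_M F \<in> series_P"
proof -
  define E where "E = fps_embed (fps_at_0 F)"
  define G where "G = F / E"
  have E: "E \<in> series_P"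
    unfolding E_def using assms by (intro fps_embed_in_series_P fps_at_0_nth_0)
  hence E0: "fps_nth E 0 \<noteq> 0" by (simp add: series_P_def)
  have G_eq: "G = F * inverse E"
    unfolding G_def using E0 by (rule fps_divide_unit)
  have G: "G \<in> series_P"
    unfolding G_eq using assms E by (intro series_P_mult series_P_inverse)
  have GE: "G * E = F"
    using E0 by (simp add: G_eq mult.assoc inverse_mult_eq_1)
  have "fps_at_0 G * fps_at_0 F = fps_at_0 F"
    using series_P_mult(2)[OF G E] by (simp add: GE) (simp add: E_def)
  moreover have "fps_at_0 F \<noteq> 0"
    using fps_at_0_nth_0[OF assms] by auto
  ultimately have G1: "fps_at_0 G = 1" by simp
  have nth: "fps_nth (map_M F) d = fps_nth G d + of_nat d * (fps_nth G d / ratfun_w)" for d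
    unfolding map_M_def Let_def E_def[symmetric] G_def[symmetric]
    by (cases d) (simp_all add: mult.assoc del: of_nat_Suc)
  have "regular_at_0 (fps_nth (map_M F) d)" for d
  proof (cases "d = 0")
    case True
    thus ?thesis using G by (simp add: nth series_P_def)
  next
    case False
    have "eval_at_0 (fps_nth G d) = fps_nth (fps_at_0 G) d"
      by (simp add: fps_at_0_def)
    also have "\<dots> = 0" using False by (simp add: G1)
    finally show ?thesis
      unfolding nth using G
      by (intro regular_at_0_add regular_at_0_mult regular_at_0_divide_w) (auto simp: series_P_def)
  qed
  thus ?thesis using G by (simp add: series_P_def nth)
qed

lemma hypergeometric_F_in_series_P:
  assumes "n > 0"
  shows "hypergeometric_F n \<in> series_P"
proof -
  have reg: "regular_at_0 ((ratfun_w + of_nat r) ^ n - ratfun_w ^ n)" for r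
    by (intro regular_at_0_diff regular_at_0_power regular_at_0_add) auto
  have ev: "eval_at_0 ((ratfun_w + of_nat r) ^ n - ratfun_w ^ n) = of_nat r ^ n" for r
    using assms
    by (simp add: eval_at_0_diff eval_at_0_power eval_at_0_add regular_at_0_power regular_at_0_add)
  show ?thesis
    unfolding series_P_def hypergeometric_F_def divide_inverse
    by (auto intro!: regular_at_0_mult regular_at_0_inverse regular_at_0_prod regular_at_0_add reg
        simp: eval_at_0_prod reg ev)
qed

end

theory Submission
  imports Defs
begin

text \<open>
  With \<open>D = x d/dx + w\<close> one has \<open>w * M F = D (F / F(0,x))\<close>. If \<open>T\<close> is a differential operator of
  order \<open>m\<close> in \<open>D\<close> with coefficients in \<open>\<rat>[[x]]\<close> and \<open>T F = w * A\<close> with \<open>A\<close> regular at \<open>w = 0\<close>, then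
  \<open>T (F(0,x) G) = c G + T' (D G)\<close> for \<open>G = F / F(0,x)\<close>, with \<open>T'\<close> of order \<open>m - 1\<close>; setting \<open>w = 0\<close>
  forces \<open>c = 0\<close>, whence \<open>T' (M F) = A\<close>. The series \<open>F\<^sub>0\<close> obtained from the hypergeometric one by
  shifting the numerator product to \<open>0 \<le> r < nd\<close> satisfies \<open>F\<^sub>0(0,x) = 1\<close>, \<open>M F\<^sub>0 = F\<close> and
  \<open>T F\<^sub>0 = w\<^sup>n F\<^sub>0\<close> for an operator \<open>T\<close> of order \<open>n\<close>. After \<open>n\<close> steps \<open>c(x) M\<^sup>n F\<^sub>0 = F\<^sub>0\<close>, and since
  \<open>M\<close> is insensitive to factors depending on \<open>x\<close> only, \<open>M\<^sup>n F = M (M\<^sup>n F\<^sub>0) = M F\<^sub>0 = F\<close>.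
\<close>

section \<open>Rational series in x as series constant in w\<close>

lemma ratfun_const_add: "ratfun_const (a + b) = ratfun_const a + ratfun_const b"
  by (simp add: ratfun_const_def)

lemma ratfun_const_mult: "ratfun_const (a * b) = ratfun_const a * ratfun_const b"
  by (simp add: ratfun_const_def mult.commute)

lemma ratfun_const_sum: "ratfun_const (sum f A) = (\<Sum>i\<in>A. ratfun_const (f i))"
  by (induction A rule: infinite_finite_induct) (auto simp: ratfun_const_add)

lemma fps_embed_nth [simp]: "fps_nth (fps_embed f) d = ratfun_const (fps_nth f d)"
  by (simp add: fps_embed_def)

lemma fps_embed_0 [simp]: "fps_embed 0 = 0"
  by (simp add: fps_eq_iff)

lemma fps_embed_1 [simp]: "fps_embed 1 = 1"
  by (simp add: fps_eq_iff)

lemma fps_embed_X [simp]: "fps_embed fps_X = fps_X"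
  by (simp add: fps_eq_iff)

lemma fps_embed_of_nat [simp]: "fps_embed (of_nat k) = of_nat k"
  by (simp add: fps_eq_iff ratfun_const_of_nat fps_of_nat[symmetric])

lemma fps_embed_add: "fps_embed (f + g) = fps_embed f + fps_embed g"
  by (simp add: fps_eq_iff ratfun_const_add)

lemma fps_embed_mult: "fps_embed (f * g) = fps_embed f * fps_embed g"
  by (simp add: fps_eq_iff fps_mult_nth ratfun_const_sum ratfun_const_mult)

lemma fps_embed_deriv: "fps_embed (fps_deriv f) = fps_deriv (fps_embed f)"
  by (simp add: fps_eq_iff ratfun_const_mult ratfun_const_of_nat del: of_nat_Suc)

text \<open>Dropping the constant-term condition of \<open>series_P\<close> gives closure under sums
  and differences, as the values of operators require.\<close>

definition regular_series :: "ratfun fps \<Rightarrow> bool" where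
  "regular_series F \<longleftrightarrow> (\<forall>d. regular_at_0 (fps_nth F d))"

lemma series_P_iff: "F \<in> series_P \<longleftrightarrow> fps_nth F 0 = 1 \<and> regular_series F"
  by (simp add: series_P_def regular_series_def)

lemma regular_series_0 [simp]: "regular_series 0"
  and regular_series_embed [simp]: "regular_series (fps_embed f)"
  by (simp_all add: regular_series_def)

lemma regular_series_const [simp]: "regular_series (fps_const c) \<longleftrightarrow> regular_at_0 c"
  by (auto simp: regular_series_def)

lemma
  assumes "regular_series F" "regular_series G"
  shows regular_series_add: "regular_series (F + G)"
    and regular_series_diff: "regular_series (F - G)"
    and regular_series_mult: "regular_series (F * G)"
    and fps_at_0_mult: "fps_at_0 (F * G) = fps_at_0 F * fps_at_0 G"
  using assms
  by (auto simp: regular_series_def fps_at_0_def fps_eq_iff fps_mult_nth eval_at_0_mult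
      intro!: regular_at_0_add regular_at_0_diff regular_at_0_sum regular_at_0_mult
        eval_at_0_sum[THEN trans] sum.cong)

section \<open>The operator D and differential operators built from it\<close>

definition Dw :: "ratfun fps \<Rightarrow> ratfun fps" where
  "Dw F = fps_const ratfun_w * F + fps_X * fps_deriv F"

lemma Dw_nth: "fps_nth (Dw F) d = (ratfun_w + of_nat d) * fps_nth F d"
  by (cases d) (simp_all add: Dw_def algebra_simps)

lemma Dw_const_mult: "Dw (fps_const c * F) = fps_const c * Dw F"
  by (simp add: fps_eq_iff Dw_nth mult_ac)

lemma Dw_add: "Dw (F + G) = Dw F + Dw G"
  by (simp add: fps_eq_iff Dw_nth algebra_simps)

text \<open>Leibniz rule: only the summand x d/dx of D differentiates \<open>f\<close>.\<close>

lemma Dw_embed_mult: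
  "Dw (fps_embed f * G) = fps_embed f * Dw G + fps_embed (fps_X * fps_deriv f) * G"
  by (simp add: Dw_def fps_embed_mult fps_embed_deriv algebra_simps)

lemma regular_series_Dw: "regular_series F \<Longrightarrow> regular_series (Dw F)"
  by (auto simp: regular_series_def Dw_nth intro!: regular_at_0_mult regular_at_0_add)

text \<open>
  \<open>diffops m\<close> consists of the operators \<open>\<Sum>r<m. c\<^sub>r(x) D\<^sup>r\<close>; thus \<open>m\<close> bounds the order plus one.
\<close>
primrec diffops :: "nat \<Rightarrow> (ratfun fps \<Rightarrow> ratfun fps) set" where
  "diffops 0 = {\<lambda>G. 0}"
| "diffops (Suc m) = {\<lambda>G. fps_embed c * G + T (Dw G) | c T. T \<in> diffops m}"

lemma diffops_0: "T \<in> diffops 0 \<longleftrightarrow> T = (\<lambda>G. 0)"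
  by simp

lemma diffops_SucI: "T \<in> diffops m \<Longrightarrow> (\<lambda>G. fps_embed c * G + T (Dw G)) \<in> diffops (Suc m)"
  by auto

lemma diffops_SucE:
  assumes "T \<in> diffops (Suc m)"
  obtains c T' where "T = (\<lambda>G. fps_embed c * G + T' (Dw G))" "T' \<in> diffops m"
  using assms by auto

declare diffops.simps [simp del]

lemma diffops_induct [consumes 1, case_names zero Suc]:
  assumes "T \<in> diffops m" and "P 0 (\<lambda>G. 0)"
    and "\<And>T m c. T \<in> diffops m \<Longrightarrow> P m T \<Longrightarrow> P (Suc m) (\<lambda>G. fps_embed c * G + T (Dw G))"
  shows "P m T"
  using assms(1)
proof (induction m arbitrary: T)
  case 0
  thus ?case using assms(2) by (simp add: diffops_0)
next
  case (Suc m)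
  from Suc.prems obtain c T' where "T = (\<lambda>G. fps_embed c * G + T' (Dw G))" "T' \<in> diffops m"
    by (rule diffops_SucE)
  thus ?case using assms(3)[OF _ Suc.IH] by simp
qed

lemma diffops_comp_Dw: "T \<in> diffops m \<Longrightarrow> (\<lambda>G. T (Dw G)) \<in> diffops (Suc m)"
  using diffops_SucI[of T m 0] by simp

lemma diffops_zero_op: "(\<lambda>G. 0) \<in> diffops m"
  by (induction m) (auto simp: diffops_0 dest: diffops_comp_Dw)

lemma diffops_id: "(\<lambda>G. G) \<in> diffops (Suc m)"
  using diffops_SucI[OF diffops_zero_op, of 1 m] by simp

lemma diffops_Suc_mono: "T \<in> diffops m \<Longrightarrow> T \<in> diffops (Suc m)"
  by (induction rule: diffops_induct) (auto intro: diffops_zero_op diffops_SucI)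

lemma diffops_add:
  "S \<in> diffops m \<Longrightarrow> T \<in> diffops m \<Longrightarrow> (\<lambda>G. S G + T G) \<in> diffops m"
proof (induction arbitrary: T rule: diffops_induct)
  case zero
  thus ?case by simp
next
  case (Suc S m c)
  from Suc.prems obtain c' T' where T: "T = (\<lambda>G. fps_embed c' * G + T' (Dw G))" "T' \<in> diffops m"
    by (rule diffops_SucE)
  have "(\<lambda>G. fps_embed (c + c') * G + (S (Dw G) + T' (Dw G))) \<in> diffops (Suc m)"
    using diffops_SucI[OF Suc.IH[OF T(2)]] .
  thus ?case by (simp add: T fps_embed_add algebra_simps)
qed

lemma diffops_embed_mult:
  "T \<in> diffops m \<Longrightarrow> (\<lambda>G. fps_embed f * T G) \<in> diffops m"
proof (induction rule: diffops_induct)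
  case zero
  thus ?case by (simp add: diffops_0)
next
  case (Suc T m c)
  show ?case
    using diffops_SucI[OF Suc.IH, of "f * c"] by (simp add: fps_embed_mult algebra_simps)
qed

text \<open>Scalars here come from the whole field of rational functions of w, so a factor w can be
  pulled out of an operator.\<close>

lemma diffops_linear:
  assumes "T \<in> diffops m"
  shows "T (F + G) = T F + T G" "T (fps_const c * F) = fps_const c * T F"
  using assms
  by (induction arbitrary: F G rule: diffops_induct)
    (simp_all add: Dw_add Dw_const_mult distrib_left add_ac mult.left_commute)

text \<open>By the Leibniz rule, moving \<open>f\<close> past one D costs a term of lower order with
  x f' in place of \<open>f\<close>; hence the induction over all \<open>f\<close>.\<close>

lemma diffops_comp_embed_mult:
  "T \<in> diffops m \<Longrightarrow> (\<lambda>G. T (fps_embed f * G)) \<in> diffops m"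
proof (induction arbitrary: f rule: diffops_induct)
  case zero
  thus ?case by (simp add: diffops_0)
next
  case (Suc T m c)
  have "(\<lambda>G. (fps_embed (c * f) * G + T (fps_embed f * Dw G))
      + T (fps_embed (fps_X * fps_deriv f) * G)) \<in> diffops (Suc m)"
    by (intro diffops_add diffops_SucI[OF Suc.IH] diffops_Suc_mono Suc.IH)
  thus ?case
    by (simp add: Dw_embed_mult diffops_linear(1)[OF Suc.hyps] fps_embed_mult add.assoc mult.assoc)
qed

lemma diffops_regular_series:
  "T \<in> diffops m \<Longrightarrow> regular_series F \<Longrightarrow> regular_series (T F)"
proof (induction arbitrary: F rule: diffops_induct)
  case zero
  show ?case by simp
next
  case (Suc T m c)
  show ?case
    by (intro regular_series_add regular_series_mult regular_series_embed Suc.IH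
        regular_series_Dw Suc.prems)
qed

section \<open>\<open>map_M\<close> expressed through D, and the lowering of orders\<close>

text \<open>With G = F / F(0,x), this trades both divisions in \<open>map_M\<close>, by F(0,x) and
  by w, for equations between products.\<close>

lemma map_M_eq:
  assumes "F \<in> series_P"
  obtains G where "G \<in> series_P" "fps_at_0 G = 1" "F = fps_embed (fps_at_0 F) * G"
    "Dw G = fps_const ratfun_w * map_M F"
proof
  define E where "E = fps_embed (fps_at_0 F)"
  define G where "G = F / E"
  have E: "E \<in> series_P"
    unfolding E_def using assms by (intro fps_embed_in_series_P fps_at_0_nth_0)
  hence E0: "fps_nth E 0 \<noteq> 0" by (simp add: series_P_def)
  have G_eq: "G = F * inverse E"
    unfolding G_def using E0 by (rule fps_divide_unit)
  show G: "G \<in> series_P"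
    unfolding G_eq using assms E by (intro series_P_mult series_P_inverse)
  have GE: "F = E * G"
    using E0 inverse_mult_eq_1[OF E0] by (simp add: G_eq mult_ac)
  thus "F = fps_embed (fps_at_0 F) * G" unfolding E_def .
  have "fps_at_0 F * fps_at_0 G = fps_at_0 F"
    using series_P_mult(2)[OF E G, folded GE, symmetric] by (simp only: E_def fps_at_0_embed)
  moreover have "fps_at_0 F \<noteq> 0"
    using fps_at_0_nth_0[OF assms] by auto
  ultimately show "fps_at_0 G = 1" by simp
  have "fps_nth (map_M F) d = fps_nth G d + of_nat d * (fps_nth G d / ratfun_w)" for d
    unfolding map_M_def Let_def E_def[symmetric] G_def[symmetric]
    by (cases d) (simp_all add: mult.assoc del: of_nat_Suc)
  thus "Dw G = fps_const ratfun_w * map_M F"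
    by (simp add: fps_eq_iff Dw_nth distrib_left distrib_right)
qed

lemma fps_const_w_mult_cancel:
  "fps_const ratfun_w * F = fps_const ratfun_w * G \<longleftrightarrow> F = G"
  by (simp add: fps_eq_iff)

text \<open>The factor \<open>c\<close> does not involve w, so it also appears in the value at w = 0
  and cancels from the quotient.\<close>

lemma map_M_embed_mult:
  assumes F: "F \<in> series_P" and c: "fps_nth c 0 = 1"
  shows "map_M (fps_embed c * F) = map_M F"
proof -
  have cF: "fps_embed c * F \<in> series_P"
    using F c by (intro series_P_mult fps_embed_in_series_P)
  have at_0: "fps_at_0 (fps_embed c * F) = c * fps_at_0 F"
    using F by (subst fps_at_0_mult) (auto simp: series_P_iff)
  have nz: "fps_embed (c * fps_at_0 F) \<noteq> 0"
    using c fps_at_0_nth_0[OF F] by (auto simp: fps_eq_iff intro!: exI[of _ 0])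
  obtain G where G: "G \<in> series_P" "fps_at_0 G = 1" "F = fps_embed (fps_at_0 F) * G"
      "Dw G = fps_const ratfun_w * map_M F"
    by (rule map_M_eq[OF F])
  obtain H where H: "H \<in> series_P" "fps_at_0 H = 1"
      "fps_embed c * F = fps_embed (fps_at_0 (fps_embed c * F)) * H"
      "Dw H = fps_const ratfun_w * map_M (fps_embed c * F)"
    by (rule map_M_eq[OF cF])
  have "fps_embed (c * fps_at_0 F) * H = fps_embed c * F"
    by (simp only: H(3)[symmetric] at_0[symmetric])
  also have "\<dots> = fps_embed (c * fps_at_0 F) * G"
    by (simp only: fps_embed_mult mult.assoc G(3)[symmetric])
  finally have "H = G" using nz by simp
  with G(4) H(4) show ?thesis by (simp add: fps_const_w_mult_cancel)
qed

lemma map_M_lowers_order: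
  assumes T: "T \<in> diffops (Suc m)" and F: "F \<in> series_P"
    and A: "regular_series A" and eq: "T F = fps_const ratfun_w * A"
  shows "\<exists>T'\<in>diffops m. T' (map_M F) = A"
proof -
  define H where "H = map_M F"
  obtain G where G: "G \<in> series_P" "fps_at_0 G = 1" "F = fps_embed (fps_at_0 F) * G"
      "Dw G = fps_const ratfun_w * H"
    unfolding H_def by (rule map_M_eq[OF F])
  \<comment> \<open>Writing T(F(0,x) G) in powers of D isolates the coefficient \<open>c\<close> of
    order 0; the rest acts on D G, which is w times \<open>H\<close>.\<close>
  obtain c T' where T': "(\<lambda>G. T (fps_embed (fps_at_0 F) * G)) = (\<lambda>G. fps_embed c * G + T' (Dw G))"
      "T' \<in> diffops m"
    using diffops_comp_embed_mult[OF T] by (rule diffops_SucE)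
  have "T F = fps_embed c * G + T' (Dw G)"
    using fun_cong[OF T'(1), of G] by (simp only: G(3)[symmetric])
  hence *: "fps_embed c * G = fps_const ratfun_w * (A - T' H)"
    unfolding eq G(4) by (simp add: diffops_linear(2)[OF T'(2)] right_diff_distrib eq_diff_eq)
  have "regular_series H"
    using map_M_in_series_P[OF F] by (simp add: H_def series_P_iff)
  \<comment> \<open>Multiplicativity of \<open>fps_at_0\<close> is available for regular series, so
    the cofactor of w must be regular before w is set to 0.\<close>
  hence "regular_series (A - T' H)"
    by (intro regular_series_diff A diffops_regular_series[OF T'(2)])
  moreover have "fps_at_0 (fps_const ratfun_w) = 0"
    by (simp add: fps_at_0_def fps_eq_iff)
  ultimately have "fps_at_0 (fps_embed c * G) = 0"
    unfolding * by (simp add: fps_at_0_mult)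
  hence "c = 0"
    using G(1,2) by (simp add: fps_at_0_mult series_P_iff)
  with * have "fps_const ratfun_w * (A - T' H) = fps_const ratfun_w * 0"
    by simp
  hence "T' H = A"
    unfolding fps_const_w_mult_cancel by simp
  with T'(2) show ?thesis unfolding H_def by blast
qed

lemma map_M_iterate_in_series_P: "F \<in> series_P \<Longrightarrow> (map_M ^^ k) F \<in> series_P"
  by (induction k) (auto intro: map_M_in_series_P)

text \<open>Each application of \<open>map_M\<close> uses up one factor w and lowers the order bound
  by one; the remaining right-hand side stays regular.\<close>

lemma map_M_iterate_lowers_order:
  assumes "T \<in> diffops (k + m)" "F \<in> series_P" "regular_series A"
    and "T F = fps_const (ratfun_w ^ k) * A"
  shows "\<exists>T'\<in>diffops m. T' ((map_M ^^ k) F) = A"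
  using assms
proof (induction k arbitrary: T F)
  case 0
  thus ?case by auto
next
  case (Suc k)
  have reg: "regular_series (fps_const (ratfun_w ^ k) * A)"
    using Suc.prems(3) by (intro regular_series_mult) (auto intro: regular_at_0_power)
  have "T F = fps_const ratfun_w * (fps_const (ratfun_w ^ k) * A)"
    unfolding Suc.prems(4) by (simp only: power_Suc fps_const_mult[symmetric] mult.assoc)
  moreover have "T \<in> diffops (Suc (k + m))"
    using Suc.prems(1) by simp
  ultimately obtain T' where "T' \<in> diffops (k + m)" "T' (map_M F) = fps_const (ratfun_w ^ k) * A"
    using map_M_lowers_order[where T = T, OF _ Suc.prems(2) reg] by blast
  from Suc.IH[OF this(1) map_M_in_series_P[OF Suc.prems(2)] Suc.prems(3) this(2)]
  show ?case by (simp add: funpow_swap1)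
qed

section \<open>The shifted hypergeometric series\<close>

definition shifted_F :: "nat \<Rightarrow> ratfun fps" where
  "shifted_F n = Abs_fps (\<lambda>d.
     (\<Prod>r<n*d. (of_nat n * ratfun_w + of_nat r)) /
     (\<Prod>r=1..d. ((ratfun_w + of_nat r) ^ n - ratfun_w ^ n)))"

lemma
  assumes "n > 0"
  shows regular_denominator: "regular_at_0 ((ratfun_w + of_nat r) ^ n - ratfun_w ^ n)"
    and eval_denominator: "eval_at_0 ((ratfun_w + of_nat r) ^ n - ratfun_w ^ n) = of_nat r ^ n"
  using assms
  by (auto simp: eval_at_0_diff eval_at_0_power eval_at_0_add regular_at_0_power regular_at_0_add
      intro!: regular_at_0_diff regular_at_0_power regular_at_0_add)

text \<open>Already the value at w = 0, which is \<open>of_nat r ^ n\<close>, is nonzero.\<close>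

lemma denominator_nonzero:
  assumes "n > 0" "r > 0"
  shows "(ratfun_w + of_nat r) ^ n - ratfun_w ^ n \<noteq> 0"
  using eval_denominator[OF assms(1), of r] assms(2) by auto

lemma shifted_F_in_series_P:
  assumes "n > 0"
  shows "shifted_F n \<in> series_P"
  using assms unfolding series_P_def shifted_F_def divide_inverse
  by (auto intro!: regular_at_0_mult regular_at_0_inverse regular_at_0_prod regular_at_0_add
      regular_denominator simp: eval_at_0_prod regular_denominator eval_denominator)

text \<open>For d > 0 the numerator contains the factor n w from r = 0, while the denominator takes
  the nonzero value (d!)^n at w = 0.\<close>

lemma fps_at_0_shifted_F:
  assumes "n > 0"
  shows "fps_at_0 (shifted_F n) = 1"
proof (rule fps_ext)
  fix d
  show "fps_nth (fps_at_0 (shifted_F n)) d = fps_nth 1 d"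
  proof (cases "d = 0")
    case True
    thus ?thesis by (simp add: fps_at_0_def shifted_F_def)
  next
    case False
    define P where "P = (\<Prod>r<n*d. (of_nat n * ratfun_w + of_nat r))"
    define Q where "Q = (\<Prod>r=1..d. ((ratfun_w + of_nat r) ^ n - ratfun_w ^ n))"
    have P: "regular_at_0 P"
      unfolding P_def by (intro regular_at_0_prod regular_at_0_add regular_at_0_mult) auto
    have "eval_at_0 P = (\<Prod>r<n*d. of_nat r)"
      unfolding P_def by (subst eval_at_0_prod)
        (auto simp: eval_at_0_add eval_at_0_mult regular_at_0_mult intro!: regular_at_0_add)
    also have "\<dots> = 0" using assms False by (auto intro!: bexI[of _ 0])
    finally have P0: "eval_at_0 P = 0" .
    have Q: "regular_at_0 Q" "eval_at_0 Q \<noteq> 0"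
      using assms unfolding Q_def
      by (auto intro!: regular_at_0_prod regular_denominator
          simp: eval_at_0_prod regular_denominator eval_denominator)
    have "eval_at_0 (P * inverse Q) = 0"
      using P P0 Q by (simp add: eval_at_0_mult regular_at_0_inverse)
    thus ?thesis
      using False by (simp add: fps_at_0_def shifted_F_def P_def Q_def divide_inverse)
  qed
qed

text \<open>D multiplies coefficient d by w + d. Now n (w + d) is the factor r = n d, extending the
  numerator at its upper end; splitting off the factor n w of r = 0 leaves the range 1..nd.\<close>

lemma Dw_shifted_F:
  assumes "n > 0"
  shows "Dw (shifted_F n) = fps_const ratfun_w * hypergeometric_F n"
proof (rule fps_ext)
  fix d
  let ?p = "\<lambda>r. of_nat n * ratfun_w + of_nat r :: ratfun"
  have "of_nat n * ((ratfun_w + of_nat d) * (\<Prod>r<n*d. ?p r)) = (\<Prod>r<Suc (n*d). ?p r)"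
    by (simp add: algebra_simps)
  also have "\<dots> = ?p 0 * (\<Prod>r<n*d. ?p (Suc r))"
    by (rule prod.lessThan_Suc_shift)
  also have "(\<Prod>r<n*d. ?p (Suc r)) = (\<Prod>r=1..n*d. ?p r)"
    by (rule prod.reindex_bij_witness[of _ "\<lambda>r. r - 1" Suc]) auto
  finally have "(ratfun_w + of_nat d) * (\<Prod>r<n*d. ?p r) = ratfun_w * (\<Prod>r=1..n*d. ?p r)"
    using assms by (simp add: mult.assoc)
  thus "fps_nth (Dw (shifted_F n)) d = fps_nth (fps_const ratfun_w * hypergeometric_F n) d"
    by (simp add: Dw_nth shifted_F_def hypergeometric_F_def)
qed

lemma map_M_shifted_F:
  assumes "n > 0"
  shows "map_M (shifted_F n) = hypergeometric_F n"
proof -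
  obtain G where G: "G \<in> series_P" "fps_at_0 G = 1"
      "shifted_F n = fps_embed (fps_at_0 (shifted_F n)) * G"
      "Dw G = fps_const ratfun_w * map_M (shifted_F n)"
    by (rule map_M_eq[OF shifted_F_in_series_P[OF assms]])
  have "G = shifted_F n"
    using G(3) by (simp add: fps_at_0_shifted_F assms)
  with G(4) show ?thesis
    by (simp add: Dw_shifted_F assms fps_const_w_mult_cancel)
qed

section \<open>The hypergeometric differential equation\<close>

lemma diffops_Dw_power: "(\<lambda>G. Abs_fps (\<lambda>d. (ratfun_w + of_nat d) ^ k * fps_nth G d)) \<in> diffops (Suc k)"
proof (induction k)
  case 0
  show ?case using diffops_id[of 0] by (simp add: fps_nth_inverse)
next
  case (Suc k)
  show ?case using diffops_comp_Dw[OF Suc] by (simp add: Dw_nth mult_ac)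
qed

text \<open>This operator is the product of the factors n D + j over j < k; the induction splits off
  the last one.\<close>

lemma diffops_rising_product:
  "(\<lambda>G. Abs_fps (\<lambda>d. (\<Prod>j<k. of_nat n * (ratfun_w + of_nat d) + of_nat j) * fps_nth G d))
    \<in> diffops (Suc k)" (is "?P k \<in> _")
proof (induction k)
  case 0
  show ?case using diffops_id[of 0] by (simp add: fps_nth_inverse)
next
  case (Suc k)
  have "(\<lambda>G. fps_embed (of_nat n) * ?P k (Dw G) + fps_embed (of_nat k) * ?P k G)
      \<in> diffops (Suc (Suc k))"
    by (intro diffops_add diffops_embed_mult diffops_comp_Dw[OF Suc] diffops_Suc_mono Suc)
  also have "(\<lambda>G. fps_embed (of_nat n) * ?P k (Dw G) + fps_embed (of_nat k) * ?P k G) = ?P (Suc k)"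
    by (rule ext) (simp add: fps_eq_iff Dw_nth algebra_simps)
  finally show ?case .
qed

text \<open>From d to d + 1 the numerator gains the n factors r = nd, ..., nd + n - 1, and the
  denominator gains the single factor moved to the left.\<close>

lemma shifted_F_recurrence:
  assumes "n > 0"
  shows "((ratfun_w + of_nat (Suc d)) ^ n - ratfun_w ^ n) * fps_nth (shifted_F n) (Suc d)
    = (\<Prod>j<n. of_nat n * (ratfun_w + of_nat d) + of_nat j) * fps_nth (shifted_F n) d"
proof -
  let ?p = "\<lambda>r. of_nat n * ratfun_w + of_nat r :: ratfun"
  have "(\<Prod>r<n * Suc d. ?p r) = (\<Prod>r<n * d. ?p r) * (\<Prod>r=n*d..<n*d+n. ?p r)"
    by (simp add: lessThan_atLeast0 prod.atLeastLessThan_concat add.commute)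
  also have "(\<Prod>r=n*d..<n*d+n. ?p r) = (\<Prod>j<n. ?p (n * d + j))"
    by (rule prod.reindex_bij_witness[of _ "\<lambda>j. n * d + j" "\<lambda>r. r - n * d"]) auto
  also have "\<dots> = (\<Prod>j<n. of_nat n * (ratfun_w + of_nat d) + of_nat j)"
    by (simp add: algebra_simps)
  finally show ?thesis
    using denominator_nonzero[OF assms, of "Suc d"]
    by (simp add: shifted_F_def prod.atLeast_Suc_atMost del: of_nat_Suc)
qed

text \<open>The operator is D^n minus x times the product of n D + j over j < n. Multiplication by x
  shifts the index, so coefficient d + 1 of the equation is the recurrence at d; coefficient 0 reads
  w^n = w^n.\<close>

lemma shifted_F_equation:
  assumes "n > 0"
  shows "\<exists>T\<in>diffops (Suc n). T (shifted_F n) = fps_const (ratfun_w ^ n) * shifted_F n"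
proof
  let ?D = "\<lambda>G. Abs_fps (\<lambda>d. (ratfun_w + of_nat d) ^ n * fps_nth G d)"
  let ?P = "\<lambda>G. Abs_fps (\<lambda>d. (\<Prod>j<n. of_nat n * (ratfun_w + of_nat d) + of_nat j) * fps_nth G d)"
  let ?T = "\<lambda>G. ?D G + fps_embed (- fps_X) * ?P G"
  show "?T \<in> diffops (Suc n)"
    by (intro diffops_add diffops_embed_mult diffops_Dw_power diffops_rising_product)
  have X: "fps_embed (- fps_X) = - fps_X"
    using fps_embed_add[of fps_X "- fps_X"] by (simp add: eq_neg_iff_add_eq_0 add.commute)
  show "?T (shifted_F n) = fps_const (ratfun_w ^ n) * shifted_F n"
  proof (rule fps_ext)
    fix d
    show "fps_nth (?T (shifted_F n)) d = fps_nth (fps_const (ratfun_w ^ n) * shifted_F n) d"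
      using shifted_F_recurrence[OF assms, of "d - 1"]
      by (cases d) (simp_all add: X algebra_simps)
  qed
qed

theorem theorem1:
  fixes n :: nat
  assumes "n > 0"
  shows "(map_M ^^ n) (hypergeometric_F n) = hypergeometric_F n"
proof -
  let ?F0 = "shifted_F n"
  have F0: "?F0 \<in> series_P" "regular_series ?F0"
    using shifted_F_in_series_P[OF assms] by (auto simp: series_P_iff)
  have iter: "(map_M ^^ n) ?F0 \<in> series_P"
    using F0(1) by (rule map_M_iterate_in_series_P)
  \<comment> \<open>The bound n + 1 allows order n; after n lowering steps
    \<open>diffops (Suc 0)\<close> remains, the multiplications by a series in x.\<close>
  obtain T where "T \<in> diffops (n + Suc 0)" "T ?F0 = fps_const (ratfun_w ^ n) * ?F0"
    using shifted_F_equation[OF assms] by auto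
  from map_M_iterate_lowers_order[OF this(1) F0 this(2)]
  obtain T' where T': "T' \<in> diffops (Suc 0)" "T' ((map_M ^^ n) ?F0) = ?F0"
    by blast
  from T'(1) obtain c where "T' = (\<lambda>G. fps_embed c * G)"
    by (elim diffops_SucE) (auto simp: diffops_0)
  with T'(2) have c: "fps_embed c * (map_M ^^ n) ?F0 = ?F0"
    by simp
  \<comment> \<open>Both series have constant term 1, hence so does \<open>c\<close>, as cancelling
    it inside \<open>map_M\<close> requires.\<close>
  have "ratfun_const (fps_nth c 0) = 1"
    using arg_cong[OF c, of "\<lambda>F. fps_nth F 0"] iter F0(1) by (simp add: series_P_iff)
  hence c0: "fps_nth c 0 = 1"
    using eval_at_0_const[of "fps_nth c 0"] by simp
  have "(map_M ^^ n) (hypergeometric_F n) = (map_M ^^ n) (map_M ?F0)"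
    by (simp add: map_M_shifted_F assms)
  also have "\<dots> = map_M (fps_embed c * (map_M ^^ n) ?F0)"
    by (simp add: map_M_embed_mult[OF iter c0] funpow_swap1)
  also have "\<dots> = hypergeometric_F n"
    by (simp add: c map_M_shifted_F assms)
  finally show ?thesis .
qed

end
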